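(* Let $(c^{l,n}_{i,j})$, $l=1,\dots,M$, $n=0,1,2,\dots$, be ion concentrations computed by the hybrid scheme with periodic boundary conditions, i.e. satisfying for all $l,n,i,j$ $$\frac{c^{l,n+1}_{i,j}-c^{l,n}_{i,j}}{\Delta t}=-\frac{J^{l,n}_{i+\frac12,j}-J^{l,n}_{i-\frac12,j}}{\Delta x}-\frac{J^{l,n}_{i,j+\frac12}-J^{l,n}_{i,j-\frac12}}{\Delta y},$$ where the numerical fluxes $J^{l,n}$ are determined by the electric displacement values $D^n$ as specified in the context. Then, whatever the real values $D^n_{i+\frac12,j}$, $D^n_{i,j+\frac12}$ are (in particular, whatever values the neural network produces for the variable $\boldsymbol\Theta$ that enters their computation), the scheme preserves positivity: for every $l\in\{1,\dots,M\}$ and every $n\ge0$, if $c^{l,n}_{i,j}>0$ for all $i,j$, then $c^{l,n+1}_{i,j}>0$ for all $i,j$.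
   Context: The scheme is a finite-difference discretisation, on a two-dimensional uniform rectangular grid with $N_x\times N_y$ points ($N_x,N_y$ positive integers), of the Nernst--Planck equations $\partial_t c^l=-\nabla\cdot \boldsymbol J^l$, $\boldsymbol J^l=-(\nabla c^l-\frac{q^l c^l}{\epsilon}\boldsymbol D)$, $l=1,\dots,M$, where $c^l$ is the concentration and $q^l\in\mathbb Z$ the valence of the $l$-th ion species, $\epsilon>0$ is the permittivity (a function of position), and $\boldsymbol D$ is the electric displacement. Here $\Delta x,\Delta y,\Delta t>0$ are the grid sizes and the time step. Periodic boundary conditions mean that the index $i$ is taken modulo $N_x$ and $j$ modulo $N_y$, for grid-point quantities and for half-index (edge) quantities alike. Let $B(x)=\frac{x}{e^x-1}$ for $x\neq0$ and $B(0)=1$. The numerical fluxes are $$J^{l,n}_{i+\frac12,j}=-\frac1{\Delta x}\left(B\left(\Delta x\,q^l\frac{D^n_{i+\frac12,j}}{\epsilon_{i+\frac12,j}}\right)c^{l,n+1}_{i+1,j}-B\left(-\Delta x\,q^l\frac{D^n_{i+\frac12,j}}{\epsilon_{i+\frac12,j}}\right)c^{l,n+1}_{i,j}\right),$$ $$J^{l,n}_{i,j+\frac12}=-\frac1{\Delta y}\left(B\left(\Delta y\,q^l\frac{D^n_{i,j+\frac12}}{\epsilon_{i,j+\frac12}}\right)c^{l,n+1}_{i,j+1}-B\left(-\Delta y\,q^l\frac{D^n_{i,j+\frac12}}{\epsilon_{i,j+\frac12}}\right)c^{l,n+1}_{i,j}\right),$$ where $D^n_{i+\frac12,j}$ and $D^n_{i,j+\frac12}$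 are the edge values of the $x$- and $y$-components of the electric displacement at time step $n$, and $\epsilon_{i+\frac12,j},\epsilon_{i,j+\frac12}>0$ are edge values of the permittivity. Thus the scheme is linear and implicit in the concentrations. In the hybrid method $D^n$ is obtained from a discretised Maxwell--Ampère equation $\partial_t\boldsymbol D=-\sum_l q^l\boldsymbol J^l+\boldsymbol\Theta$, with $\boldsymbol\Theta$ produced by a neural network; for the present result the edge values of $D^n$ are arbitrary real numbers. *)

theory Defs
  imports Complex_Main
begin

definition bernoulli_fun :: "real \<Rightarrow> real" where
  "bernoulli_fun x = (if x = 0 then 1 else x / (exp x - 1))"

text \<open>Indices modulo \<open>Nx\<close> and \<open>Ny\<close> are rendered by doubly periodic functions on pairs of integers.\<close>

definition grid_periodic :: "nat \<Rightarrow> nat \<Rightarrow> (int \<Rightarrow> int \<Rightarrow> real) \<Rightarrow> bool" where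
  "grid_periodic Nx Ny u \<longleftrightarrow>
     (\<forall>i j. u (i + int Nx) j = u i j \<and> u i (j + int Ny) = u i j)"

text \<open>Edge quantities are indexed by the lower grid point of the edge: for the \<open>x\<close>-edges, the
  entry \<open>(i, j)\<close> belongs to \<open>(i + 1/2, j)\<close>; for the \<open>y\<close>-edges it belongs to \<open>(i, j + 1/2)\<close>.
  In both fluxes \<open>c\<close> stands for the concentrations at the new time level, while
  \<open>D\<close> is taken at the old one.\<close>

definition flux_x ::
  "real \<Rightarrow> int \<Rightarrow> (int \<Rightarrow> int \<Rightarrow> real) \<Rightarrow> (int \<Rightarrow> int \<Rightarrow> real) \<Rightarrow> (int \<Rightarrow> int \<Rightarrow> real)
    \<Rightarrow> int \<Rightarrow> int \<Rightarrow> real" where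
  "flux_x \<Delta>x q \<epsilon> D c i j =
     - (1 / \<Delta>x) *
       (bernoulli_fun (\<Delta>x * of_int q * (D i j / \<epsilon> i j)) * c (i + 1) j
        - bernoulli_fun (- \<Delta>x * of_int q * (D i j / \<epsilon> i j)) * c i j)"

definition flux_y ::
  "real \<Rightarrow> int \<Rightarrow> (int \<Rightarrow> int \<Rightarrow> real) \<Rightarrow> (int \<Rightarrow> int \<Rightarrow> real) \<Rightarrow> (int \<Rightarrow> int \<Rightarrow> real)
    \<Rightarrow> int \<Rightarrow> int \<Rightarrow> real" where
  "flux_y \<Delta>y q \<epsilon> D c i j =
     - (1 / \<Delta>y) *
       (bernoulli_fun (\<Delta>y * of_int q * (D i j / \<epsilon> i j)) * c i (j + 1)
        - bernoulli_fun (- \<Delta>y * of_int q * (D i j / \<epsilon> i j)) * c i j)"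

end

(* Sum the scheme over the grid points where the new concentration u is nonpositive. Since the
   scheme is conservative, only fluxes across the boundary of this set S survive, and positivity of
   the Bernoulli function makes each of them point into S. So the sum of u over S is at least the
   sum of the old concentration over S, which is positive unless S is empty; but it is also
   nonpositive. *)
theory Submission
  imports Defs
begin

text \<open>For \<open>x \<noteq> 0\<close> the numerator \<open>x\<close> and the denominator
  \<open>exp x - 1\<close> have the same sign.\<close>

lemma bernoulli_fun_pos: "bernoulli_fun x > 0"
  by (cases x "0 :: real" rule: linorder_cases)
    (simp_all add: bernoulli_fun_def divide_neg_neg)

lemma sum_periodic_shift:
  fixes f :: "int \<Rightarrow> real"
  assumes "\<And>i. f (i + int N) = f i"
  shows "(\<Sum>a<N. f (i + int a - 1)) = (\<Sum>a<N. f (i + int a))"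
proof -
  have "(\<Sum>a<N. f (i + int a) - f (i + int a - 1)) = f (i + int N - 1) - f (i - 1)"
    using sum_lessThan_telescope[of "\<lambda>a. f (i + int a - 1)" N] by (simp add: algebra_simps)
  also have "\<dots> = 0"
    using assms[of "i - 1"] by (simp add: algebra_simps)
  finally show ?thesis
    by (simp add: sum_subtractf)
qed

text \<open>Summation by parts over one full period, so that no boundary terms remain. With
  \<open>\<chi>\<close> an indicator function, only edges with exactly one endpoint in the set
  contribute on the right.\<close>

lemma sum_by_parts_periodic:
  fixes \<chi> F :: "int \<Rightarrow> real"
  assumes "\<And>i. \<chi> (i + int N) = \<chi> i" and "\<And>i. F (i + int N) = F i"
  shows "(\<Sum>a<N. \<chi> (i + int a) * (F (i + int a) - F (i + int a - 1))) =
    (\<Sum>a<N. F (i + int a) * (\<chi> (i + int a) - \<chi> (i + int a + 1)))"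
proof -
  \<comment> \<open>The product pairs \<open>F\<close> on an edge with \<open>\<chi>\<close> at the
    upper endpoint of that edge; shifting its sum by one index aligns the two sides.\<close>
  have "\<chi> (k + int N + 1) * F (k + int N) = \<chi> (k + 1) * F k" for k
    using assms(1)[of "k + 1"] assms(2)[of k] by (simp add: algebra_simps)
  from sum_periodic_shift[of "\<lambda>k. \<chi> (k + 1) * F k", OF this]
  show ?thesis
    by (simp add: right_diff_distrib sum_subtractf mult.commute)
qed

text \<open>Contribution of a single edge with endpoint values \<open>u\<close> (lower) and
  \<open>v\<close> (upper). If exactly one of them is nonpositive, positivity of \<open>a\<close>
  and \<open>b\<close> fixes the sign of \<open>a * v - b * u\<close>, and the flux points towards
  that endpoint.\<close>

lemma flux_across_nonpos_set:
  fixes h a b u v :: real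
  assumes "h > 0" "a > 0" "b > 0"
  shows "- (1 / h) * (a * v - b * u) * (of_bool (u \<le> 0) - of_bool (v \<le> 0)) \<le> 0"
proof -
  consider "u \<le> 0 \<longleftrightarrow> v \<le> 0" | "u \<le> 0" "v > 0" | "u > 0" "v \<le> 0"
    by linarith
  then show ?thesis
  proof cases
    case 2
    then have "a * v - b * u \<ge> 0"
      using assms mult_nonneg_nonneg[of a v] mult_nonneg_nonpos[of b u] by linarith
    with 2 assms show ?thesis by simp
  next
    case 3
    then have "a * v - b * u \<le> 0"
      using assms mult_nonneg_nonneg[of b u] mult_nonneg_nonpos[of a v] by linarith
    with 3 assms show ?thesis by (simp add: divide_nonpos_pos)
  qed auto
qed

lemma sum_flux_x_nonpos_set:
  assumes "h > 0" and "grid_periodic Nx Ny \<epsilon>" "grid_periodic Nx Ny D" "grid_periodic Nx Ny u"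
  shows "(\<Sum>a<Nx. of_bool (u (i + int a) j \<le> 0) *
    (flux_x h q \<epsilon> D u (i + int a) j - flux_x h q \<epsilon> D u (i + int a - 1) j)) \<le> 0"
proof -
  have per: "flux_x h q \<epsilon> D u (k + int Nx) j = flux_x h q \<epsilon> D u k j" for k
  proof -
    \<comment> \<open>The flux also reads \<open>u\<close> at the upper endpoint of the edge, so
      periodicity is needed at \<open>k + 1\<close> too.\<close>
    have "u ((k + 1) + int Nx) j = u (k + 1) j"
      using assms(4) unfolding grid_periodic_def by blast
    also have "(k + 1) + int Nx = k + int Nx + 1"
      by simp
    finally have "u (k + int Nx + 1) j = u (k + 1) j" .
    with assms(2-4) show ?thesis
      by (simp add: grid_periodic_def flux_x_def)
  qed
  have perc: "of_bool (u (k + int Nx) j \<le> 0) = (of_bool (u k j \<le> 0) :: real)" for k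
    using assms(4) by (simp add: grid_periodic_def)
  \<comment> \<open>Both Bernoulli coefficients are positive whatever the sign of their arguments;
    hence \<open>D\<close> may be arbitrary.\<close>
  have "flux_x h q \<epsilon> D u k j * (of_bool (u k j \<le> 0) - of_bool (u (k + 1) j \<le> 0)) \<le> 0" for k
    unfolding flux_x_def using assms(1) bernoulli_fun_pos bernoulli_fun_pos
    by (rule flux_across_nonpos_set)
  then show ?thesis
    using sum_by_parts_periodic[of "\<lambda>k. of_bool (u k j \<le> 0)" Nx "\<lambda>k. flux_x h q \<epsilon> D u k j" i,
        OF perc per]
    by (simp add: sum_nonpos)
qed

text \<open>Transposing the grid carries the estimate for \<open>x\<close>-edges over to
  \<open>y\<close>-edges.\<close>

lemma flux_y_eq_flux_x:
  "flux_y h q \<epsilon> D u i j = flux_x h q (\<lambda>j i. \<epsilon> i j) (\<lambda>j i. D i j) (\<lambda>j i. u i j) j i"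
  by (simp add: flux_x_def flux_y_def)

lemma grid_periodic_swap: "grid_periodic Nx Ny u \<Longrightarrow> grid_periodic Ny Nx (\<lambda>j i. u i j)"
  by (simp add: grid_periodic_def)

lemma sum_flux_y_nonpos_set:
  assumes "h > 0" and "grid_periodic Nx Ny \<epsilon>" "grid_periodic Nx Ny D" "grid_periodic Nx Ny u"
  shows "(\<Sum>b<Ny. of_bool (u i (j + int b) \<le> 0) *
    (flux_y h q \<epsilon> D u i (j + int b) - flux_y h q \<epsilon> D u i (j + int b - 1))) \<le> 0"
  using sum_flux_x_nonpos_set[OF assms(1) assms(2-4)[THEN grid_periodic_swap],
      where i = j and j = i and q = q]
  by (simp add: flux_y_eq_flux_x)

text \<open>One time step for one species: \<open>f\<close> is the old concentration,
  \<open>u\<close> the new one.\<close>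

lemma implicit_step_pos:
  fixes \<Delta>x \<Delta>y \<Delta>t :: real and u f :: "int \<Rightarrow> int \<Rightarrow> real"
  assumes "Nx > 0" "Ny > 0" and pos: "\<Delta>x > 0" "\<Delta>y > 0" "\<Delta>t > 0"
    and per: "grid_periodic Nx Ny \<epsilon>x" "grid_periodic Nx Ny \<epsilon>y"
      "grid_periodic Nx Ny Dx" "grid_periodic Nx Ny Dy" "grid_periodic Nx Ny u"
    and step: "\<And>i j. (u i j - f i j) / \<Delta>t =
        - (flux_x \<Delta>x q \<epsilon>x Dx u i j - flux_x \<Delta>x q \<epsilon>x Dx u (i - 1) j) / \<Delta>x
        - (flux_y \<Delta>y q \<epsilon>y Dy u i j - flux_y \<Delta>y q \<epsilon>y Dy u i (j - 1)) / \<Delta>y"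
    and f: "\<And>i j. f i j > 0"
  shows "u i j > 0"
proof (rule ccontr)
  assume "\<not> u i j > 0"
  define \<chi> :: "int \<Rightarrow> int \<Rightarrow> real" where "\<chi> k l = of_bool (u k l \<le> 0)" for k l
  define Gx where "Gx k l = flux_x \<Delta>x q \<epsilon>x Dx u k l - flux_x \<Delta>x q \<epsilon>x Dx u (k - 1) l" for k l
  define Gy where "Gy k l = flux_y \<Delta>y q \<epsilon>y Dy u k l - flux_y \<Delta>y q \<epsilon>y Dy u k (l - 1)" for k l
  \<comment> \<open>The period window starts at the offending point, so no reduction of indices is needed.\<close>
  define S where "S g = (\<Sum>a<Nx. \<Sum>b<Ny. g (i + int a) (j + int b))"
    for g :: "int \<Rightarrow> int \<Rightarrow> real"
  \<comment> \<open>The sums are exchanged so that the inner one runs along a grid row, where the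
    one-dimensional bound applies.\<close>
  have "S (\<lambda>k l. \<chi> k l * Gx k l) =
      (\<Sum>b<Ny. \<Sum>a<Nx. \<chi> (i + int a) (j + int b) * Gx (i + int a) (j + int b))"
    unfolding S_def by (rule sum.swap)
  also have "\<dots> \<le> 0"
    unfolding \<chi>_def Gx_def using pos(1) per(1,3,5) by (intro sum_nonpos sum_flux_x_nonpos_set)
  finally have x: "S (\<lambda>k l. \<chi> k l * Gx k l) / \<Delta>x \<le> 0"
    using pos(1) by (rule divide_nonpos_pos)
  have "S (\<lambda>k l. \<chi> k l * Gy k l) \<le> 0"
    unfolding S_def \<chi>_def Gy_def using pos(2) per(2,4,5)
    by (intro sum_nonpos sum_flux_y_nonpos_set)
  then have y: "S (\<lambda>k l. \<chi> k l * Gy k l) / \<Delta>y \<le> 0"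
    using pos(2) by (rule divide_nonpos_pos)
  \<comment> \<open>The scheme is multiplied by the indicator and then summed over one
    period.\<close>
  have "\<chi> k l * ((u k l - f k l) / \<Delta>t) = - (\<chi> k l * Gx k l / \<Delta>x) - \<chi> k l * Gy k l / \<Delta>y" for k l
    unfolding step Gx_def[symmetric] Gy_def[symmetric] by (simp add: right_diff_distrib)
  then have "S (\<lambda>k l. \<chi> k l * ((u k l - f k l) / \<Delta>t)) =
      - (S (\<lambda>k l. \<chi> k l * Gx k l) / \<Delta>x) - S (\<lambda>k l. \<chi> k l * Gy k l) / \<Delta>y"
    by (simp add: S_def sum_subtractf sum_negf sum_divide_distrib)
  with x y have "S (\<lambda>k l. \<chi> k l * ((u k l - f k l) / \<Delta>t)) \<ge> 0"
    by linarith
  \<comment> \<open>Where \<open>\<chi>\<close> is nonzero, \<open>u \<le> 0 < f\<close> makes the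
    summand negative. Strictness of the sum comes from the offending point, which has offsets
    \<open>a = b = 0\<close> in the window.\<close>
  moreover have "S (\<lambda>k l. \<chi> k l * ((u k l - f k l) / \<Delta>t)) < 0"
  proof -
    have *: "(u k l - f k l) / \<Delta>t < 0" if "u k l \<le> 0" for k l
      using that f[of k l] pos(3) by (intro divide_neg_pos) auto
    then have le: "\<chi> k l * ((u k l - f k l) / \<Delta>t) \<le> 0" for k l
      by (auto simp: \<chi>_def intro: less_imp_le)
    have lt: "\<chi> i j * ((u i j - f i j) / \<Delta>t) < 0"
      using *[of i j] \<open>\<not> u i j > 0\<close> by (simp add: \<chi>_def)
    let ?g = "\<lambda>k l. - (\<chi> k l * ((u k l - f k l) / \<Delta>t))"
    have "0 < (\<Sum>a<Nx. \<Sum>b<Ny. ?g (i + int a) (j + int b))"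
      using le lt \<open>Nx > 0\<close> \<open>Ny > 0\<close>
      by (intro sum_pos2[where i = 0] sum_nonneg) auto
    then show ?thesis
      by (simp add: S_def sum_negf)
  qed
  ultimately show False by simp
qed

theorem mainTheorem2:
  fixes M Nx Ny :: nat
    and \<Delta>x \<Delta>y \<Delta>t :: real
    and q :: "nat \<Rightarrow> int"
    and \<epsilon>x \<epsilon>y :: "int \<Rightarrow> int \<Rightarrow> real"
    and Dx Dy :: "nat \<Rightarrow> int \<Rightarrow> int \<Rightarrow> real"
    and c :: "nat \<Rightarrow> nat \<Rightarrow> int \<Rightarrow> int \<Rightarrow> real"
  assumes "Nx > 0" and "Ny > 0"
    and "\<Delta>x > 0" and "\<Delta>y > 0" and "\<Delta>t > 0"
    and "\<And>i j. \<epsilon>x i j > 0" and "\<And>i j. \<epsilon>y i j > 0"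
    and "grid_periodic Nx Ny \<epsilon>x" and "grid_periodic Nx Ny \<epsilon>y"
    and "\<And>n. grid_periodic Nx Ny (Dx n)" and "\<And>n. grid_periodic Nx Ny (Dy n)"
    and "\<And>l n. l \<in> {1..M} \<Longrightarrow> grid_periodic Nx Ny (c l n)"
    and scheme: "\<And>l n i j. l \<in> {1..M} \<Longrightarrow>
      (c l (n + 1) i j - c l n i j) / \<Delta>t =
        - (flux_x \<Delta>x (q l) \<epsilon>x (Dx n) (c l (n + 1)) i j
           - flux_x \<Delta>x (q l) \<epsilon>x (Dx n) (c l (n + 1)) (i - 1) j) / \<Delta>x
        - (flux_y \<Delta>y (q l) \<epsilon>y (Dy n) (c l (n + 1)) i j
           - flux_y \<Delta>y (q l) \<epsilon>y (Dy n) (c l (n + 1)) i (j - 1)) / \<Delta>y"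
  shows "\<forall>l\<in>{1..M}. \<forall>n. (\<forall>i j. c l n i j > 0) \<longrightarrow> (\<forall>i j. c l (n + 1) i j > 0)"
proof (intro ballI allI impI)
  fix l n i j
  assume l: "l \<in> {1..M}" and old: "\<forall>i j. c l n i j > 0"
  show "c l (n + 1) i j > 0"
    \<comment> \<open>With \<open>Dx n\<close> and \<open>Dy n\<close> given, the species decouple,
      so each can be treated separately.\<close>
    by (rule implicit_step_pos[OF assms(1-5,8-11) assms(12)[OF l] scheme[OF l]])
      (use old in blast)
qed

end
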